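(* Let $(\Omega,\Sigma,\mathbb P)$ be a probability space, and let $\beta>0$, $\epsilon>0$, $\theta>0$. (i) The mean-deviation risk function $\rho^{\mathrm{MD}}:\mathcal L^2(\Omega;\mathbb R)\to\mathbb R$, $\rho^{\mathrm{MD}}(X)=\mathbb E[X]+\beta\|X-\mathbb E[X]\|_2$, is Fréchet differentiable at every $X\in\mathcal L^2(\Omega;\mathbb R)$ that is not almost surely constant, with derivative $D\rho^{\mathrm{MD}}(X)\in\mathcal L^2(\Omega;\mathbb R)$ given by $$D\rho^{\mathrm{MD}}(X)=1+\beta\frac{X-\mathbb E[X]}{\|X-\mathbb E[X]\|_2}.$$ Moreover, the derivative does not exist at $X\in\mathcal L^2(\Omega;\mathbb R)$ such that $X=\mathbb E[X]$. It additionally has the $\mathcal L$-derivative that reads, for all $\mu\in\mathcal P^2(\mathbb R)$ that are not Dirac measures, $$D\rho^{\mathrm{MD}}(\mu)(x)=1+\beta\frac{x-\int x'\mu(dx')}{\left[\int\left(x''-\int x'\mu(dx')\right)^2\mu(dx'')\right]^{1/2}}\qquad\forall x\in\mathbb R.$$ (ii) The restriction to $\mathcal L^2(\Omega;\mathbb R)$ of the $\epsilon$-smoothed mean-semideviation risk function $\rho^{\mathrm{MD}+}_\epsilon(X)=\mathbb E[X]+\beta\,\mathbb E[(X-\mathbb E[X])_{\epsilon+}]$, where $(x)_{\epsilon+}=x+\epsilon\ln(1+e^{-x/\epsilon})$, is Fréchet differentiable at every $X\in\mathcal L^2(\Omega;\mathbb R)$, and has the Fréchet- and $\mathcal L$-derivatives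 $$D\rho^{\mathrm{MD}+}_\epsilon(X)=1+\beta\bigl\{U_\epsilon(X-\mathbb E[X])-\mathbb E[U_\epsilon(X-\mathbb E[X])]\bigr\}\in\mathcal L^\infty(\Omega;\mathbb R)\qquad\forall X\in\mathcal L^2(\Omega;\mathbb R),$$ $$D\rho^{\mathrm{MD}+}_\epsilon(\mu)(x)=1+\beta\Bigl\{U_\epsilon\Bigl(x-\int x'\mu(dx')\Bigr)-\int U_\epsilon\Bigl(x''-\int x'\mu(dx')\Bigr)\mu(dx'')\Bigr\}\in(1-\beta,1+\beta)$$ for all $\mu\in\mathcal P^2(\mathbb R)$, $x\in\mathbb R$, respectively, where $U_\epsilon(x)=\frac{d}{dx}(x)_{\epsilon+}=1/(1+e^{-x/\epsilon})$ for all $x\in\mathbb R$. (iii) The entropic risk measure $\rho^{\mathrm{Ent}}:\mathcal L^\infty(\Omega;\mathbb R)\to\mathbb R$, $\rho^{\mathrm{Ent}}(X)=\frac1\theta\ln\mathbb E[e^{\theta X}]$, is Fréchet differentiable at every $X\in\mathcal L^\infty(\Omega;\mathbb R)$, with the Fréchet- and $\mathcal L$-derivatives $D\rho^{\mathrm{Ent}}(X)\in\mathcal L^1(\Omega;\mathbb R)$ and $D\rho^{\mathrm{Ent}}(\mu):\mathbb R\to\mathbb R$, $\mu\in\mathcal P^\infty(\mathbb R)$, $$D\rho^{\mathrm{Ent}}(X)=\frac{e^{\theta X}}{\mathbb E[e^{\theta X}]},\qquad D\rho^{\mathrm{Ent}}(\mu)(x)=\frac{e^{\theta x}}{\int e^{\theta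 x'}\mu(dx')}\qquad\forall x\in\mathbb R.$$
   Context: $\mathcal P^p(\mathbb R)$, $p\in[1,\infty)$, is the set of Borel probability measures on $\mathbb R$ with finite $p$-th moment; $\mathcal P^\infty(\mathbb R)$ those with bounded support. $\|\cdot\|_2$ is the $\mathcal L^2$-norm. Fréchet derivatives of $F:\mathcal L^p(\Omega;\mathbb R)\to\mathbb R$ at $X$ are identified with random variables $DF(X)\in\mathcal L^{p/(p-1)}(\Omega;\mathbb R)$ (with $p/(p-1)=1$ for $p=\infty$) via $\langle DF(X),Y\rangle=\mathbb E[DF(X)\,Y]$, so that $F(X+Y)-F(X)-\mathbb E[DF(X)Y]\in o(\|Y\|_p)$. $\mathcal L$-derivative: a law invariant $\rho$ (i.e. $\rho(X)$ depends only on the law of $X$) is regarded as a function on $\mathcal P^p(\mathbb R)$; a function $D\rho(\mu):\mathbb R\to\mathbb R$ is an $\mathcal L$-derivative of $\rho$ at $\mu$ if, for $X\in\mathcal L^p(\Omega;\mathbb R)$ with law $\mu$, the Fréchet derivative of $\rho$ at $X$ satisfies $D\rho(X)(\omega)=D\rho(\mu)(X(\omega))$ for $\mathbb P$-almost all $\omega$.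
   Formalization: The claim in (i) that the derivative does not exist at X = E[X] is stated only for probability spaces having an event A with 0 < P(A) < 1; otherwise every X is a.s. constant, ρ^MD = E is linear, and the derivative exists. *)

theory Defs
  imports "HOL-Probability.Probability" "HOL-Library.Landau_Symbols"
begin

section \<open>The spaces $L^p$ for exponents between 1 and infinity\<close>

text \<open>Elements are functions, not almost-everywhere classes, so \<open>Lp_norm\<close> is only a seminorm;
  equality of elements of the quotient space is almost-everywhere equality of functions.
  The definitions are meaningful for \<open>1 \<le> p \<le> \<infinity>\<close>.\<close>

definition Lp_space :: "'a measure \<Rightarrow> ennreal \<Rightarrow> ('a \<Rightarrow> real) set" where
  "Lp_space M p = {X \<in> borel_measurable M.
     if p = \<infinity> then esssup M (\<lambda>\<omega>. ereal \<bar>X \<omega>\<bar>) < \<infinity>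
     else integrable M (\<lambda>\<omega>. \<bar>X \<omega>\<bar> powr enn2real p)}"

definition Lp_norm :: "'a measure \<Rightarrow> ennreal \<Rightarrow> ('a \<Rightarrow> real) \<Rightarrow> real" where
  "Lp_norm M p X =
     (if p = \<infinity> then real_of_ereal (esssup M (\<lambda>\<omega>. ereal \<bar>X \<omega>\<bar>))
      else (\<integral>\<omega>. \<bar>X \<omega>\<bar> powr enn2real p \<partial>M) powr (1 / enn2real p))"

text \<open>For \<open>p = 1\<close> the quotient is \<open>1 / 0 = \<infinity>\<close> in \<^typ>\<open>ennreal\<close>.\<close>

definition conj_exponent :: "ennreal \<Rightarrow> ennreal" where
  "conj_exponent p = (if p = \<infinity> then 1 else p / (p - 1))"


section \<open>Frechet derivatives on $L^p$\<close>

definition bounded_linear_functional_Lp ::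
    "'a measure \<Rightarrow> ennreal \<Rightarrow> (('a \<Rightarrow> real) \<Rightarrow> real) \<Rightarrow> bool" where
  "bounded_linear_functional_Lp M p L \<longleftrightarrow>
     (\<forall>X\<in>Lp_space M p. \<forall>Y\<in>Lp_space M p. L (\<lambda>\<omega>. X \<omega> + Y \<omega>) = L X + L Y) \<and>
     (\<forall>c. \<forall>X\<in>Lp_space M p. L (\<lambda>\<omega>. c * X \<omega>) = c * L X) \<and>
     (\<exists>K. \<forall>X\<in>Lp_space M p. \<bar>L X\<bar> \<le> K * Lp_norm M p X)"

text \<open>The filter of neighbourhoods of 0 in \<open>Lp_space M p\<close>, i.e. \<open>\<parallel>Y\<parallel>\<^sub>p \<rightarrow> 0\<close> with \<open>Y\<close> in the space.\<close>

definition Lp_nhds_zero :: "'a measure \<Rightarrow> ennreal \<Rightarrow> ('a \<Rightarrow> real) filter" where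
  "Lp_nhds_zero M p = inf (filtercomap (Lp_norm M p) (nhds 0)) (principal (Lp_space M p))"

definition has_Frechet_derivative_Lp ::
    "'a measure \<Rightarrow> ennreal \<Rightarrow> (('a \<Rightarrow> real) \<Rightarrow> real) \<Rightarrow> (('a \<Rightarrow> real) \<Rightarrow> real) \<Rightarrow> ('a \<Rightarrow> real) \<Rightarrow> bool" where
  "has_Frechet_derivative_Lp M p F L X \<longleftrightarrow>
     X \<in> Lp_space M p \<and> bounded_linear_functional_Lp M p L \<and>
     (\<lambda>Y. F (\<lambda>\<omega>. X \<omega> + Y \<omega>) - F X - L Y) \<in> o[Lp_nhds_zero M p](Lp_norm M p)"

text \<open>The Frechet derivative at \<open>X\<close>, identified with a random variable \<open>D\<close> in the space of
  conjugate exponent through the pairing \<open>Y \<mapsto> E[D Y]\<close>.  Such a \<open>D\<close> is unique almost surely.\<close>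

definition has_Lp_derivative ::
    "'a measure \<Rightarrow> ennreal \<Rightarrow> (('a \<Rightarrow> real) \<Rightarrow> real) \<Rightarrow> ('a \<Rightarrow> real) \<Rightarrow> ('a \<Rightarrow> real) \<Rightarrow> bool" where
  "has_Lp_derivative M p F D X \<longleftrightarrow>
     D \<in> Lp_space M (conj_exponent p) \<and>
     has_Frechet_derivative_Lp M p F (\<lambda>Y. \<integral>\<omega>. D \<omega> * Y \<omega> \<partial>M) X"


section \<open>Probability measures on the real line and \<open>\<L>\<close>-derivatives\<close>

definition measure_support :: "real measure \<Rightarrow> real set" where
  "measure_support \<mu> = {x. \<forall>U. open U \<and> x \<in> U \<longrightarrow> emeasure \<mu> U > 0}"

definition prob_measures_Lp :: "ennreal \<Rightarrow> real measure set" where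
  "prob_measures_Lp p = {\<mu>. prob_space \<mu> \<and> sets \<mu> = sets borel \<and>
     (if p = \<infinity> then bounded (measure_support \<mu>)
      else integrable \<mu> (\<lambda>x. \<bar>x\<bar> powr enn2real p))}"

definition law_invariant ::
    "'a measure \<Rightarrow> ennreal \<Rightarrow> (('a \<Rightarrow> real) \<Rightarrow> real) \<Rightarrow> bool" where
  "law_invariant M p \<rho> \<longleftrightarrow>
     (\<forall>X\<in>Lp_space M p. \<forall>Y\<in>Lp_space M p. distr M borel X = distr M borel Y \<longrightarrow> \<rho> X = \<rho> Y)"

text \<open>\<open>g\<close> is an \<open>\<L>\<close>-derivative of \<open>\<rho>\<close> at \<open>\<mu>\<close>: at every random variable \<open>X\<close> of law \<open>\<mu>\<close> the Frechet
  derivative exists and is almost surely \<open>g \<circ> X\<close>.\<close>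

definition has_L_derivative ::
    "'a measure \<Rightarrow> ennreal \<Rightarrow> (('a \<Rightarrow> real) \<Rightarrow> real) \<Rightarrow> (real \<Rightarrow> real) \<Rightarrow> real measure \<Rightarrow> bool" where
  "has_L_derivative M p \<rho> g \<mu> \<longleftrightarrow>
     law_invariant M p \<rho> \<and>
     (\<forall>X\<in>Lp_space M p. distr M borel X = \<mu> \<longrightarrow>
        (\<exists>D. has_Lp_derivative M p \<rho> D X \<and> (AE \<omega> in M. D \<omega> = g (X \<omega>))))"


section \<open>The risk functions\<close>

definition rho_MD :: "'a measure \<Rightarrow> real \<Rightarrow> ('a \<Rightarrow> real) \<Rightarrow> real" where
  "rho_MD M \<beta> X = (\<integral>\<omega>. X \<omega> \<partial>M) + \<beta> * Lp_norm M 2 (\<lambda>\<omega>. X \<omega> - (\<integral>\<omega>'. X \<omega>' \<partial>M))"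

definition smooth_pos :: "real \<Rightarrow> real \<Rightarrow> real" where
  "smooth_pos \<epsilon> x = x + \<epsilon> * ln (1 + exp (- x / \<epsilon>))"

definition U_smooth :: "real \<Rightarrow> real \<Rightarrow> real" where
  "U_smooth \<epsilon> x = 1 / (1 + exp (- x / \<epsilon>))"

definition rho_MD_plus :: "'a measure \<Rightarrow> real \<Rightarrow> real \<Rightarrow> ('a \<Rightarrow> real) \<Rightarrow> real" where
  "rho_MD_plus M \<beta> \<epsilon> X =
     (\<integral>\<omega>. X \<omega> \<partial>M) + \<beta> * (\<integral>\<omega>. smooth_pos \<epsilon> (X \<omega> - (\<integral>\<omega>'. X \<omega>' \<partial>M)) \<partial>M)"

definition rho_Ent :: "'a measure \<Rightarrow> real \<Rightarrow> ('a \<Rightarrow> real) \<Rightarrow> real" where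
  "rho_Ent M \<theta> X = 1 / \<theta> * ln (\<integral>\<omega>. exp (\<theta> * X \<omega>) \<partial>M)"

end

(* Every derivative comes from a remainder that is quadratic in the norm.  Write Z = X - E X,
   V = Y - E Y, s = |Z|, u = |Z + V| and c = E[Z V].  Cauchy-Schwarz gives s u >= s^2 + c and
   AM-GM gives 2 s u <= s^2 + u^2, so u - s - c / s lies between 0 and |V|^2 / (2 s).  For the smoothed
   semideviation U is Lipschitz with constant 1 / epsilon.  At an almost surely constant X the function
   is beta |t| |W| along the line t W with W centred and not null, which has a kink at t = 0. *)

theory Submission
  imports Defs
begin

section \<open>The spaces for the exponents 2 and infinity\<close>

text \<open>The increment is governed by V, while the derivative must pair with Y itself. Centring
  is self-adjoint for the pairing E[W Y], so it can be moved from Y to the other factor; this is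
  where the subtracted mean of U in the semideviation derivative comes from. Centring is also a
  contraction, so a remainder quadratic in |V| is quadratic in |Y|. The entropic measure has no
  Hilbert structure to use, and its quadratic upper bound rests on an estimate of exp near 0. The
  general criterion therefore asks for the bound only within some radius. The kink at constants
  needs an event of probability strictly between 0 and 1. Without one, every random variable is
  almost surely constant, the deviation vanishes identically, and what remains is the expectation,
  which is differentiable. The \<L>-derivatives need no further analysis: the constants in the
  Frechet derivatives are integrals of functions of X, so they can be read off the law.\<close>

lemma abs_powr_two: "\<bar>x :: real\<bar> powr 2 = x\<^sup>2"
  by (cases "x = 0") auto

lemma Lp_space_2_iff:
  "X \<in> Lp_space M 2 \<longleftrightarrow> X \<in> borel_measurable M \<and> integrable M (\<lambda>\<omega>. (X \<omega>)\<^sup>2)"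
  by (simp add: Lp_space_def abs_powr_two)

lemma Lp_norm_2: "Lp_norm M 2 X = sqrt (\<integral>\<omega>. (X \<omega>)\<^sup>2 \<partial>M)"
  by (simp add: Lp_norm_def abs_powr_two powr_half_sqrt)

lemma Lp_norm_2_nonneg: "0 \<le> Lp_norm M 2 X"
  by (simp add: Lp_norm_2)

lemma Lp_norm_2_power2: "(Lp_norm M 2 X)\<^sup>2 = (\<integral>\<omega>. (X \<omega>)\<^sup>2 \<partial>M)"
  by (simp add: Lp_norm_2)

lemma conj_exponent_2: "conj_exponent 2 = 2"
proof -
  have "(2::ennreal) - 1 = 1"
    using ennreal_minus[of 1 2] by simp
  then show ?thesis
    using divide_ennreal[of 2 1] by (simp add: conj_exponent_def)
qed

lemma Lp_space_2_integrable_mult: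
  assumes "X \<in> Lp_space M 2" "Y \<in> Lp_space M 2"
  shows "integrable M (\<lambda>\<omega>. X \<omega> * Y \<omega>)"
proof (rule Bochner_Integration.integrable_bound)
  show "integrable M (\<lambda>\<omega>. (X \<omega>)\<^sup>2 + (Y \<omega>)\<^sup>2)"
    using assms by (simp add: Lp_space_2_iff)
  show "(\<lambda>\<omega>. X \<omega> * Y \<omega>) \<in> borel_measurable M"
    using assms by (auto simp: Lp_space_2_iff)
  have "\<bar>x * y\<bar> \<le> x\<^sup>2 + y\<^sup>2" for x y :: real
    using sum_squares_bound[of x y] sum_squares_bound[of x "- y"] sum_power2_ge_zero[of x y]
    by (simp add: abs_le_iff)
  then show "AE \<omega> in M. norm (X \<omega> * Y \<omega>) \<le> norm ((X \<omega>)\<^sup>2 + (Y \<omega>)\<^sup>2)"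
    by simp
qed

lemma Lp_space_2_add:
  assumes "X \<in> Lp_space M 2" "Y \<in> Lp_space M 2"
  shows "(\<lambda>\<omega>. X \<omega> + Y \<omega>) \<in> Lp_space M 2"
  using assms Lp_space_2_integrable_mult[OF assms]
  by (auto simp: Lp_space_2_iff power2_sum mult.assoc)

lemma Lp_space_2_scale:
  "X \<in> Lp_space M 2 \<Longrightarrow> (\<lambda>\<omega>. c * X \<omega>) \<in> Lp_space M 2"
  by (auto simp: Lp_space_2_iff power_mult_distrib)

lemma Lp_norm_2_scale: "Lp_norm M 2 (\<lambda>\<omega>. c * X \<omega>) = \<bar>c\<bar> * Lp_norm M 2 X"
  by (simp add: Lp_norm_2 power_mult_distrib real_sqrt_mult)

lemma Lp_norm_2_add_power2:
  assumes "X \<in> Lp_space M 2" "Y \<in> Lp_space M 2"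
  shows "(Lp_norm M 2 (\<lambda>\<omega>. X \<omega> + Y \<omega>))\<^sup>2 =
    (Lp_norm M 2 X)\<^sup>2 + 2 * (\<integral>\<omega>. X \<omega> * Y \<omega> \<partial>M) + (Lp_norm M 2 Y)\<^sup>2"
  using assms Lp_space_2_integrable_mult[OF assms]
  by (simp add: Lp_norm_2_power2 Lp_space_2_iff power2_sum mult.assoc)

lemma Lp_norm_2_eq_0_iff:
  assumes "X \<in> Lp_space M 2"
  shows "Lp_norm M 2 X = 0 \<longleftrightarrow> (AE \<omega> in M. X \<omega> = 0)"
  using integral_nonneg_eq_0_iff_AE[of M "\<lambda>\<omega>. (X \<omega>)\<^sup>2"] assms
  by (simp add: Lp_norm_2 Lp_space_2_iff)

text \<open>The squared norm of X + t Y is a nonnegative quadratic polynomial in t. If Y is null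
  there is no minimiser, but then the pairing vanishes too.\<close>

lemma Lp_Cauchy_Schwarz:
  assumes X: "X \<in> Lp_space M 2" and Y: "Y \<in> Lp_space M 2"
  shows "\<bar>\<integral>\<omega>. X \<omega> * Y \<omega> \<partial>M\<bar> \<le> Lp_norm M 2 X * Lp_norm M 2 Y"
proof -
  define a b c where "a = Lp_norm M 2 X" and "b = Lp_norm M 2 Y" and "c = (\<integral>\<omega>. X \<omega> * Y \<omega> \<partial>M)"
  have *: "0 \<le> a\<^sup>2 + 2 * (t * c) + t\<^sup>2 * b\<^sup>2" for t
    using Lp_norm_2_add_power2[OF X Lp_space_2_scale[OF Y, of t]]
      zero_le_power2[of "Lp_norm M 2 (\<lambda>\<omega>. X \<omega> + t * Y \<omega>)"]
    unfolding Lp_norm_2_scale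
    by (simp add: power_mult_distrib a_def b_def c_def mult.left_commute[of _ t])
  have "c\<^sup>2 \<le> a\<^sup>2 * b\<^sup>2"
  proof (cases "b = 0")
    case True
    then have "AE \<omega> in M. Y \<omega> = 0"
      using Lp_norm_2_eq_0_iff[OF Y] by (simp add: b_def)
    then have "c = 0"
      unfolding c_def by (intro integral_eq_zero_AE) auto
    then show ?thesis by simp
  next
    case False
    \<comment> \<open>The value of the polynomial at its minimiser t = - c / b^2.\<close>
    have "0 \<le> a\<^sup>2 - c\<^sup>2 / b\<^sup>2"
      using *[of "- c / b\<^sup>2"] False by (simp add: power2_eq_square)
    then show ?thesis
      using False by (simp add: pos_divide_le_eq)
  qed
  then have "\<bar>c\<bar> \<le> \<bar>a * b\<bar>"
    by (metis abs_le_square_iff power_mult_distrib)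
  then show ?thesis
    by (simp add: a_def b_def c_def Lp_norm_2_nonneg abs_mult)
qed

context prob_space
begin

lemma Lp_space_2_const: "(\<lambda>_. c) \<in> Lp_space M 2"
  by (simp add: Lp_space_2_iff)

lemma Lp_space_2_integrable:
  assumes "X \<in> Lp_space M 2"
  shows "integrable M X"
  using assms unfolding Lp_space_2_iff by (blast intro: square_integrable_imp_integrable)

lemma Lp_space_2_diff_const:
  assumes "X \<in> Lp_space M 2"
  shows "(\<lambda>\<omega>. X \<omega> - c) \<in> Lp_space M 2"
  using Lp_space_2_add[OF assms Lp_space_2_const[of "- c"]] by simp

text \<open>The variance is E[X^2] - (E X)^2. This turns remainder bounds in the centred increment
  into bounds in the increment itself.\<close>

lemma Lp_norm_2_centered_le:
  assumes "X \<in> Lp_space M 2"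
  shows "Lp_norm M 2 (\<lambda>\<omega>. X \<omega> - expectation X) \<le> Lp_norm M 2 X"
  unfolding Lp_norm_2 using assms variance_eq[OF Lp_space_2_integrable[OF assms]]
  by (simp add: Lp_space_2_iff)

text \<open>Both sides equal E[W Y] - E[W] E[Y]: centring is self-adjoint.\<close>

lemma expectation_centered_mult:
  fixes W Y :: "'a \<Rightarrow> real"
  assumes "integrable M W" "integrable M Y" "integrable M (\<lambda>\<omega>. W \<omega> * Y \<omega>)"
  shows "(\<integral>\<omega>. (W \<omega> - expectation W) * Y \<omega> \<partial>M) = (\<integral>\<omega>. W \<omega> * (Y \<omega> - expectation Y) \<partial>M)"
  using assms by (simp add: left_diff_distrib right_diff_distrib)

section \<open>Almost sure bounds and integrability for essentially bounded functions\<close>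

lemma Lp_space_inf_AE:
  assumes "X \<in> Lp_space M \<infinity>"
  shows "0 \<le> Lp_norm M \<infinity> X" "AE \<omega> in M. \<bar>X \<omega>\<bar> \<le> Lp_norm M \<infinity> X"
proof -
  let ?e = "esssup M (\<lambda>\<omega>. ereal \<bar>X \<omega>\<bar>)"
  \<comment> \<open>\<open>real_of_ereal\<close> sends both infinities to 0, so the norm bounds the
    function only once the essential supremum is known to be finite. The total mass 1 excludes minus
    infinity, and membership in the space excludes plus infinity.\<close>
  have "esssup M (\<lambda>_. 0 :: ereal) \<le> ?e"
    by (rule esssup_mono) auto
  then have "0 \<le> ?e"
    by (simp add: esssup_const emeasure_space_1)
  moreover have "?e < \<infinity>"
    using assms by (simp add: Lp_space_def)
  ultimately have e: "ereal (real_of_ereal ?e) = ?e"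
    by (intro ereal_real') auto
  then show "0 \<le> Lp_norm M \<infinity> X"
    using \<open>0 \<le> ?e\<close> by (simp add: Lp_norm_def real_of_ereal_pos)
  show "AE \<omega> in M. \<bar>X \<omega>\<bar> \<le> Lp_norm M \<infinity> X"
    using esssup_AE[of "\<lambda>\<omega>. ereal \<bar>X \<omega>\<bar>" M] by (subst (asm) e[symmetric]) (simp add: Lp_norm_def)
qed

lemma Lp_space_infI:
  assumes "X \<in> borel_measurable M" "AE \<omega> in M. \<bar>X \<omega>\<bar> \<le> c"
  shows "X \<in> Lp_space M \<infinity>"
proof -
  have "esssup M (\<lambda>\<omega>. ereal \<bar>X \<omega>\<bar>) \<le> ereal c"
    using assms by (intro esssup_I) auto
  then have "esssup M (\<lambda>\<omega>. ereal \<bar>X \<omega>\<bar>) < \<infinity>"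
    by (rule le_less_trans) simp
  then show ?thesis
    using assms by (simp add: Lp_space_def)
qed

lemma Lp_space_inf_add:
  assumes X: "X \<in> Lp_space M \<infinity>" and Y: "Y \<in> Lp_space M \<infinity>"
  shows "(\<lambda>\<omega>. X \<omega> + Y \<omega>) \<in> Lp_space M \<infinity>"
proof (rule Lp_space_infI[where c = "Lp_norm M \<infinity> X + Lp_norm M \<infinity> Y"])
  show "(\<lambda>\<omega>. X \<omega> + Y \<omega>) \<in> borel_measurable M"
    using X Y by (auto simp: Lp_space_def)
  show "AE \<omega> in M. \<bar>X \<omega> + Y \<omega>\<bar> \<le> Lp_norm M \<infinity> X + Lp_norm M \<infinity> Y"
    using Lp_space_inf_AE(2)[OF X] Lp_space_inf_AE(2)[OF Y] by eventually_elim auto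
qed

lemma Lp_space_inf_mult_integrable:
  assumes "integrable M D" "Y \<in> Lp_space M \<infinity>"
  shows "integrable M (\<lambda>\<omega>. D \<omega> * Y \<omega>)"
proof (rule Bochner_Integration.integrable_bound)
  show "integrable M (\<lambda>\<omega>. Lp_norm M \<infinity> Y * D \<omega>)"
    using assms by simp
  show "(\<lambda>\<omega>. D \<omega> * Y \<omega>) \<in> borel_measurable M"
    using assms by (auto simp: Lp_space_def)
  show "AE \<omega> in M. norm (D \<omega> * Y \<omega>) \<le> norm (Lp_norm M \<infinity> Y * D \<omega>)"
    using Lp_space_inf_AE(2)[OF assms(2)]
    by eventually_elim (simp add: abs_mult mult.commute mult_left_mono)
qed

lemma Lp_space_inf_exp_integrable:
  assumes "X \<in> Lp_space M \<infinity>"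
  shows "integrable M (\<lambda>\<omega>. exp (\<theta> * X \<omega>))"
proof (rule integrable_const_bound)
  show "AE \<omega> in M. norm (exp (\<theta> * X \<omega>)) \<le> exp (\<bar>\<theta>\<bar> * Lp_norm M \<infinity> X)"
    using Lp_space_inf_AE(2)[OF assms]
  proof eventually_elim
    case (elim \<omega>)
    have "\<theta> * X \<omega> \<le> \<bar>\<theta>\<bar> * \<bar>X \<omega>\<bar>"
      by (metis abs_ge_self abs_mult)
    also have "\<dots> \<le> \<bar>\<theta>\<bar> * Lp_norm M \<infinity> X"
      using elim by (simp add: mult_left_mono)
    finally show ?case by simp
  qed
  show "(\<lambda>\<omega>. exp (\<theta> * X \<omega>)) \<in> borel_measurable M"
    using assms by (auto simp: Lp_space_def)
qed

end

section \<open>Derivatives from quadratic remainders\<close>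

text \<open>The filter pulls back two-sided neighbourhoods of 0 along the norm, hence the absolute
  value; it spares a proof, for general \<open>p\<close>, that the norm is nonnegative.\<close>

lemma eventually_Lp_nhds_zero:
  "eventually P (Lp_nhds_zero M p) \<longleftrightarrow>
    (\<exists>d>0. \<forall>Y\<in>Lp_space M p. \<bar>Lp_norm M p Y\<bar> < d \<longrightarrow> P Y)"
  (is "?L \<longleftrightarrow> ?R")
proof
  assume ?L
  then obtain Q where Q: "eventually Q (nhds 0)"
      "\<And>Y. Q (Lp_norm M p Y) \<Longrightarrow> Y \<in> Lp_space M p \<Longrightarrow> P Y"
    unfolding Lp_nhds_zero_def eventually_inf_principal eventually_filtercomap by blast
  from Q(1) obtain d where "d > 0" "\<And>x. \<bar>x\<bar> < d \<Longrightarrow> Q x"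
    unfolding eventually_nhds_metric dist_real_def by auto
  then show ?R using Q(2) by blast
next
  assume ?R
  then obtain d where "d > 0" "\<forall>Y\<in>Lp_space M p. \<bar>Lp_norm M p Y\<bar> < d \<longrightarrow> P Y"
    by blast
  then show ?L
    unfolding Lp_nhds_zero_def eventually_inf_principal eventually_filtercomap
    by (intro exI[of _ "\<lambda>x. \<bar>x\<bar> < d"]) (auto simp: eventually_nhds_metric dist_real_def)
qed

lemma has_Lp_derivativeI_quadratic:
  assumes X: "X \<in> Lp_space M p" and D: "D \<in> Lp_space M (conj_exponent p)"
    and L: "bounded_linear_functional_Lp M p (\<lambda>Y. \<integral>\<omega>. D \<omega> * Y \<omega> \<partial>M)"
    and "r > 0" and "C \<ge> 0"
    and rem: "\<And>Y. Y \<in> Lp_space M p \<Longrightarrow> \<bar>Lp_norm M p Y\<bar> < r \<Longrightarrow>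
      \<bar>F (\<lambda>\<omega>. X \<omega> + Y \<omega>) - F X - (\<integral>\<omega>. D \<omega> * Y \<omega> \<partial>M)\<bar> \<le> C * (Lp_norm M p Y)\<^sup>2"
  shows "has_Lp_derivative M p F D X"
proof -
  have "(\<lambda>Y. F (\<lambda>\<omega>. X \<omega> + Y \<omega>) - F X - (\<integral>\<omega>. D \<omega> * Y \<omega> \<partial>M)) \<in> o[Lp_nhds_zero M p](Lp_norm M p)"
  proof (rule landau_o.smallI)
    fix c :: real assume "c > 0"
    have "\<bar>F (\<lambda>\<omega>. X \<omega> + Y \<omega>) - F X - (\<integral>\<omega>. D \<omega> * Y \<omega> \<partial>M)\<bar> \<le> c * \<bar>Lp_norm M p Y\<bar>"
      \<comment> \<open>The denominator is C + 1 rather than C so that C = 0 is covered.\<close>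
      if "Y \<in> Lp_space M p" "\<bar>Lp_norm M p Y\<bar> < min r (c / (C + 1))" for Y
    proof -
      have "(C + 1) * \<bar>Lp_norm M p Y\<bar> \<le> c"
        using that \<open>C \<ge> 0\<close> by (simp add: field_simps)
      then have "C * \<bar>Lp_norm M p Y\<bar> \<le> c"
        by (simp add: distrib_right)
      from mult_right_mono[OF this, of "\<bar>Lp_norm M p Y\<bar>"]
      have "C * (Lp_norm M p Y)\<^sup>2 \<le> c * \<bar>Lp_norm M p Y\<bar>"
        by (simp add: power2_eq_square mult.assoc flip: abs_mult)
      then show ?thesis
        using rem[of Y] that by simp
    qed
    then show "\<forall>\<^sub>F Y in Lp_nhds_zero M p.
        norm (F (\<lambda>\<omega>. X \<omega> + Y \<omega>) - F X - (\<integral>\<omega>. D \<omega> * Y \<omega> \<partial>M)) \<le> c * norm (Lp_norm M p Y)"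
      unfolding eventually_Lp_nhds_zero using \<open>r > 0\<close> \<open>c > 0\<close> \<open>C \<ge> 0\<close>
      by (intro exI[of _ "min r (c / (C + 1))"]) auto
  qed
  then show ?thesis
    using X D L by (simp add: has_Lp_derivative_def has_Frechet_derivative_Lp_def)
qed

text \<open>Cauchy-Schwarz supplies \<open>Lp_norm M 2 D\<close> as the bound of the
  functional.\<close>

lemma bounded_linear_functional_Lp_2:
  assumes D: "D \<in> Lp_space M 2"
  shows "bounded_linear_functional_Lp M 2 (\<lambda>Y. \<integral>\<omega>. D \<omega> * Y \<omega> \<partial>M)"
  unfolding bounded_linear_functional_Lp_def
proof (intro conjI allI ballI exI)
  fix c X
  show "(\<integral>\<omega>. D \<omega> * (c * X \<omega>) \<partial>M) = c * (\<integral>\<omega>. D \<omega> * X \<omega> \<partial>M)"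
    by (simp add: mult.left_commute[of "D _" c])
qed (use Lp_space_2_integrable_mult[OF D] Lp_Cauchy_Schwarz[OF D] in \<open>simp_all add: distrib_left\<close>)

text \<open>The case of exponents 1 and infinity of the Hoelder inequality: Y is replaced under the
  integral by its almost sure bound.\<close>

lemma (in prob_space) bounded_linear_functional_Lp_inf:
  assumes D: "integrable M D"
  shows "bounded_linear_functional_Lp M \<infinity> (\<lambda>Y. \<integral>\<omega>. D \<omega> * Y \<omega> \<partial>M)"
proof -
  have "\<bar>\<integral>\<omega>. D \<omega> * Y \<omega> \<partial>M\<bar> \<le> (\<integral>\<omega>. \<bar>D \<omega>\<bar> \<partial>M) * Lp_norm M \<infinity> Y" if Y: "Y \<in> Lp_space M \<infinity>" for Y
  proof -
    have "\<bar>\<integral>\<omega>. D \<omega> * Y \<omega> \<partial>M\<bar> \<le> (\<integral>\<omega>. \<bar>D \<omega> * Y \<omega>\<bar> \<partial>M)"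
      by (rule integral_abs_bound)
    also have "\<dots> \<le> (\<integral>\<omega>. \<bar>D \<omega>\<bar> * Lp_norm M \<infinity> Y \<partial>M)"
    proof (rule integral_mono_AE)
      show "integrable M (\<lambda>\<omega>. \<bar>D \<omega> * Y \<omega>\<bar>)"
        by (intro integrable_abs Lp_space_inf_mult_integrable D Y)
      show "integrable M (\<lambda>\<omega>. \<bar>D \<omega>\<bar> * Lp_norm M \<infinity> Y)"
        using D by simp
      show "AE \<omega> in M. \<bar>D \<omega> * Y \<omega>\<bar> \<le> \<bar>D \<omega>\<bar> * Lp_norm M \<infinity> Y"
        using Lp_space_inf_AE(2)[OF Y] by eventually_elim (simp add: abs_mult mult_left_mono)
    qed
    finally show ?thesis by simp
  qed
  moreover have "(\<integral>\<omega>. D \<omega> * (c * X \<omega>) \<partial>M) = c * (\<integral>\<omega>. D \<omega> * X \<omega> \<partial>M)" for c X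
    by (simp add: mult.left_commute[of "D _" c])
  ultimately show ?thesis
    unfolding bounded_linear_functional_Lp_def
    using Lp_space_inf_mult_integrable[OF D] by (auto simp: distrib_left)
qed

section \<open>The mean-deviation risk function\<close>

context prob_space
begin

lemma centered_norm_pos:
  assumes X: "X \<in> Lp_space M 2" and nc: "\<not> (\<exists>c. AE \<omega> in M. X \<omega> = c)"
  shows "0 < Lp_norm M 2 (\<lambda>\<omega>. X \<omega> - expectation X)"
proof -
  have "Lp_norm M 2 (\<lambda>\<omega>. X \<omega> - expectation X) \<noteq> 0"
    using nc Lp_norm_2_eq_0_iff[OF Lp_space_2_diff_const[OF X]] by auto
  then show ?thesis
    using Lp_norm_2_nonneg by (simp add: less_le)
qed

lemma rho_MD_has_derivative:
  assumes X: "X \<in> Lp_space M 2" and nc: "\<not> (\<exists>c. AE \<omega> in M. X \<omega> = c)" and "\<beta> > 0"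
  shows "has_Lp_derivative M 2 (rho_MD M \<beta>)
    (\<lambda>\<omega>. 1 + \<beta> * ((X \<omega> - expectation X) / Lp_norm M 2 (\<lambda>\<omega>. X \<omega> - expectation X))) X"
proof -
  define Z where "Z = (\<lambda>\<omega>. X \<omega> - expectation X)"
  define s where "s = Lp_norm M 2 Z"
  have Z: "Z \<in> Lp_space M 2"
    unfolding Z_def by (rule Lp_space_2_diff_const[OF X])
  have s: "s > 0"
    unfolding s_def Z_def by (rule centered_norm_pos[OF X nc])
  define D where "D = (\<lambda>\<omega>. 1 + \<beta> * (Z \<omega> / s))"
  have D: "D \<in> Lp_space M 2"
    using Lp_space_2_add[OF Lp_space_2_const[of 1] Lp_space_2_scale[OF Z, of "\<beta> / s"]]
    by (simp add: D_def)
  have "has_Lp_derivative M 2 (rho_MD M \<beta>) D X"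
  \<comment> \<open>The estimate holds for every Y, so the radius is an arbitrary choice. The
    constant blows up as the deviation s tends to 0, in accordance with the kink at
    constants.\<close>
  proof (rule has_Lp_derivativeI_quadratic[where r = 1 and C = "\<beta> / (2 * s)"])
    fix Y assume Y: "Y \<in> Lp_space M 2"
    define V where "V = (\<lambda>\<omega>. Y \<omega> - expectation Y)"
    define u where "u = Lp_norm M 2 (\<lambda>\<omega>. Z \<omega> + V \<omega>)"
    define c where "c = (\<integral>\<omega>. Z \<omega> * V \<omega> \<partial>M)"
    note iX = Lp_space_2_integrable[OF X] and iY = Lp_space_2_integrable[OF Y]
    have V: "V \<in> Lp_space M 2"
      unfolding V_def by (rule Lp_space_2_diff_const[OF Y])
    have iZY: "integrable M (\<lambda>\<omega>. Z \<omega> * Y \<omega>)"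
      by (rule Lp_space_2_integrable_mult[OF Z Y])
    have iXY: "integrable M (\<lambda>\<omega>. X \<omega> * Y \<omega>)"
      by (rule Lp_space_2_integrable_mult[OF X Y])
    have mZ: "expectation Z = 0"
      using iX by (simp add: Z_def prob_space)
    have c: "(\<integral>\<omega>. Z \<omega> * Y \<omega> \<partial>M) = c"
      using expectation_centered_mult[OF Lp_space_2_integrable[OF Z] iY iZY]
      by (simp add: mZ c_def V_def)
    have DY: "(\<integral>\<omega>. D \<omega> * Y \<omega> \<partial>M) = expectation Y + \<beta> * (c / s)"
    proof -
      have "(\<integral>\<omega>. D \<omega> * Y \<omega> \<partial>M) = (\<integral>\<omega>. Y \<omega> + (\<beta> / s) * (Z \<omega> * Y \<omega>) \<partial>M)"
        by (simp add: D_def algebra_simps)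
      also have "\<dots> = expectation Y + \<beta> / s * c"
        using iY iZY by (simp add: c)
      finally show ?thesis by simp
    qed
    have "(\<lambda>\<omega>. X \<omega> + Y \<omega> - (\<integral>\<omega>'. X \<omega>' + Y \<omega>' \<partial>M)) = (\<lambda>\<omega>. Z \<omega> + V \<omega>)"
      using iX iY by (auto simp: Z_def V_def)
    then have rem: "rho_MD M \<beta> (\<lambda>\<omega>. X \<omega> + Y \<omega>) - rho_MD M \<beta> X - (\<integral>\<omega>. D \<omega> * Y \<omega> \<partial>M)
        = \<beta> * (u - s - c / s)"
      using iX iY unfolding rho_MD_def DY
      by (simp add: u_def s_def Z_def[symmetric] algebra_simps)
    have u2: "u\<^sup>2 = s\<^sup>2 + 2 * c + (Lp_norm M 2 V)\<^sup>2"
      unfolding u_def s_def c_def by (rule Lp_norm_2_add_power2[OF Z V])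
    \<comment> \<open>Pairing Z with Z + V, whose norm is \<open>u\<close>, gives the lower bound
      \<open>s + c / s\<close>: the convex norm lies above its tangent at Z.\<close>
    have "(\<integral>\<omega>. Z \<omega> * (Z \<omega> + V \<omega>) \<partial>M) = s\<^sup>2 + c"
      using Z Lp_space_2_integrable_mult[OF Z V]
      by (simp add: s_def c_def Lp_norm_2_power2 Lp_space_2_iff distrib_left flip: power2_eq_square)
    then have "s\<^sup>2 + c \<le> s * u"
      using Lp_Cauchy_Schwarz[OF Z Lp_space_2_add[OF Z V]] by (simp add: s_def u_def)
    then have "s + c / s \<le> u"
      using s by (simp add: field_simps power2_eq_square)
    moreover have "u - s - c / s \<le> (Lp_norm M 2 V)\<^sup>2 / (2 * s)"
    proof -
      \<comment> \<open>After inserting \<open>u2\<close>, moving two copies of s^2 and 2 c to the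
        left leaves only the square of the norm of V on the right.\<close>
      have "2 * (s * u) \<le> s\<^sup>2 + u\<^sup>2"
        using sum_squares_bound[of s u] by simp
      then have "2 * (s * u) - 2 * s\<^sup>2 - 2 * c \<le> (Lp_norm M 2 V)\<^sup>2"
        using u2 by simp
      moreover have "u - s - c / s = (2 * (s * u) - 2 * s\<^sup>2 - 2 * c) / (2 * s)"
        using s by (simp add: field_simps power2_eq_square)
      ultimately show ?thesis
        using s by (simp add: divide_right_mono)
    qed
    moreover have "(Lp_norm M 2 V)\<^sup>2 / (2 * s) \<le> (Lp_norm M 2 Y)\<^sup>2 / (2 * s)"
      using Lp_norm_2_centered_le[OF Y] s unfolding V_def
      by (intro divide_right_mono power_mono) (auto simp: Lp_norm_2_nonneg)
    ultimately have "\<bar>u - s - c / s\<bar> \<le> (Lp_norm M 2 Y)\<^sup>2 / (2 * s)"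
      by linarith
    from mult_left_mono[OF this, of \<beta>]
    show "\<bar>rho_MD M \<beta> (\<lambda>\<omega>. X \<omega> + Y \<omega>) - rho_MD M \<beta> X - (\<integral>\<omega>. D \<omega> * Y \<omega> \<partial>M)\<bar>
        \<le> \<beta> / (2 * s) * (Lp_norm M 2 Y)\<^sup>2"
      unfolding rem using \<open>\<beta> > 0\<close> by (simp add: abs_mult)
  qed (use X D s \<open>\<beta> > 0\<close> bounded_linear_functional_Lp_2[OF D] in \<open>auto simp: conj_exponent_2\<close>)
  then show ?thesis
    by (simp add: D_def s_def Z_def)
qed

text \<open>The direction is the centred indicator of \<open>A\<close>. The functional
  \<open>L\<close> is arbitrary, so a derivative is refuted even without assuming that it is
  represented by a random variable.\<close>

lemma rho_MD_not_differentiable: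
  assumes A: "A \<in> sets M" "0 < measure M A" "measure M A < 1"
    and X: "X \<in> Lp_space M 2" and c: "AE \<omega> in M. X \<omega> = expectation X" and "\<beta> > 0"
  shows "\<not> has_Frechet_derivative_Lp M 2 (rho_MD M \<beta>) L X"
proof
  assume H: "has_Frechet_derivative_Lp M 2 (rho_MD M \<beta>) L X"
  define Z where "Z = (\<lambda>\<omega>. indicator A \<omega> - measure M A)"
  define s where "s = Lp_norm M 2 Z"
  have mes [measurable]: "X \<in> borel_measurable M"
    using X by (simp add: Lp_space_2_iff)
  have I: "(indicator A :: _ \<Rightarrow> real) \<in> Lp_space M 2"
    using A(1) by (auto simp: Lp_space_2_iff power2_eq_square simp flip: indicator_inter_arith
        intro!: integrable_const_bound[of _ 1])
  then have Z: "Z \<in> Lp_space M 2"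
    unfolding Z_def by (rule Lp_space_2_diff_const)
  have mZ: "expectation Z = 0"
    using A Lp_space_2_integrable[OF I] by (simp add: Z_def prob_space)
  have "s \<noteq> 0"
  proof
    assume "s = 0"
    then have "AE \<omega> in M. Z \<omega> = 0"
      using Lp_norm_2_eq_0_iff[OF Z] by (simp add: s_def)
    \<comment> \<open>Z equals 1 - P(A) on \<open>A\<close> and - P(A) off \<open>A\<close>, and
      neither value is 0.\<close>
    then have "AE \<omega> in M. False"
    proof eventually_elim
      case (elim \<omega>)
      then show ?case
        using A by (cases "\<omega> \<in> A") (auto simp: Z_def)
    qed
    then show False by simp
  qed
  then have s: "s > 0"
    using Lp_norm_2_nonneg[of M Z] by (simp add: s_def)
  have rho: "rho_MD M \<beta> (\<lambda>\<omega>. X \<omega> + t * Z \<omega>) - rho_MD M \<beta> X = \<beta> * (\<bar>t\<bar> * s)" for t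
  proof -
    have int: "(\<integral>\<omega>. X \<omega> + t * Z \<omega> \<partial>M) = expectation X"
      using Lp_space_2_integrable[OF X] Lp_space_2_integrable[OF Z] by (simp add: mZ)
    have "Lp_norm M 2 (\<lambda>\<omega>. X \<omega> - expectation X) = 0"
      using c by (subst Lp_norm_2_eq_0_iff[OF Lp_space_2_diff_const[OF X]]) auto
    moreover have "Lp_norm M 2 (\<lambda>\<omega>. X \<omega> + t * Z \<omega> - expectation X) = Lp_norm M 2 (\<lambda>\<omega>. t * Z \<omega>)"
    proof -
      have "(\<integral>\<omega>. (X \<omega> + t * Z \<omega> - expectation X)\<^sup>2 \<partial>M) = (\<integral>\<omega>. (t * Z \<omega>)\<^sup>2 \<partial>M)"
        using c Z by (intro integral_cong_AE) (auto simp: Lp_space_2_iff)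
      then show ?thesis by (simp add: Lp_norm_2)
    qed
    ultimately show ?thesis
      by (simp add: rho_MD_def int Lp_norm_2_scale s_def)
  qed
  have L: "L (\<lambda>\<omega>. t * Z \<omega>) = t * L Z" for t
    using H Z by (auto simp: has_Frechet_derivative_Lp_def bounded_linear_functional_Lp_def)
  have "(\<lambda>Y. rho_MD M \<beta> (\<lambda>\<omega>. X \<omega> + Y \<omega>) - rho_MD M \<beta> X - L Y)
      \<in> o[Lp_nhds_zero M 2](Lp_norm M 2)"
    using H by (simp add: has_Frechet_derivative_Lp_def)
  \<comment> \<open>Any tolerance below \<beta> works: adding the estimates at t Z and - t Z cancels
    \<open>L\<close> and leaves 2 \<beta> t s bounded by twice the tolerance times t s.\<close>
  from landau_o.smallD[OF this, of "\<beta> / 2"] obtain d where "d > 0" and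
    d: "\<And>Y. Y \<in> Lp_space M 2 \<Longrightarrow> \<bar>Lp_norm M 2 Y\<bar> < d \<Longrightarrow>
      \<bar>rho_MD M \<beta> (\<lambda>\<omega>. X \<omega> + Y \<omega>) - rho_MD M \<beta> X - L Y\<bar> \<le> \<beta> / 2 * \<bar>Lp_norm M 2 Y\<bar>"
    unfolding eventually_Lp_nhds_zero using \<open>\<beta> > 0\<close> by auto
  \<comment> \<open>The norm of t Z is then d / 2, inside the ball of radius d.\<close>
  define t where "t = d / (2 * s)"
  have t: "t > 0" "t * s < d"
    using \<open>d > 0\<close> s by (auto simp: t_def)
  have *: "\<bar>\<beta> * (\<bar>x\<bar> * s) - x * L Z\<bar> \<le> \<beta> / 2 * (\<bar>x\<bar> * s)" if "\<bar>x\<bar> = t" for x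
    using d[OF Lp_space_2_scale[OF Z, of x]] that t s
    by (simp add: Lp_norm_2_scale rho L abs_mult flip: s_def)
  have "\<bar>\<beta> * (t * s) - t * L Z\<bar> \<le> \<beta> / 2 * (t * s)" "\<bar>\<beta> * (t * s) + t * L Z\<bar> \<le> \<beta> / 2 * (t * s)"
    using *[of t] *[of "- t"] t(1) by simp_all
  moreover have "\<beta> * (t * s) > 0"
    using t s \<open>\<beta> > 0\<close> by simp
  ultimately show False
    by linarith
qed

end

section \<open>The smoothed mean-semideviation risk function\<close>

lemma smooth_pos_has_derivative:
  assumes "\<epsilon> > 0"
  shows "(smooth_pos \<epsilon> has_real_derivative U_smooth \<epsilon> x) (at x)"
proof -
  have pos: "1 + exp (- x / \<epsilon>) > 0"
    by (simp add: add_pos_pos)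
  have "((\<lambda>x. x + \<epsilon> * ln (1 + exp (- x / \<epsilon>))) has_real_derivative
      1 + \<epsilon> * (exp (- x / \<epsilon>) * (- 1 / \<epsilon>) / (1 + exp (- x / \<epsilon>)))) (at x)"
    using pos assms by (auto intro!: derivative_eq_intros)
  also have "1 + \<epsilon> * (exp (- x / \<epsilon>) * (- 1 / \<epsilon>) / (1 + exp (- x / \<epsilon>))) = U_smooth \<epsilon> x"
    using pos assms by (simp add: U_smooth_def divide_simps)
  finally show ?thesis
    unfolding smooth_pos_def[abs_def] .
qed

lemma U_smooth_bounds: "0 < U_smooth \<epsilon> x" "U_smooth \<epsilon> x < 1"
  by (auto simp: U_smooth_def add_pos_pos)

text \<open>The logistic equation; writing the derivative through \<open>U_smooth\<close> itself
  lets it be bounded by the range (0, 1).\<close>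

lemma U_smooth_has_derivative:
  assumes "\<epsilon> > 0"
  shows "(U_smooth \<epsilon> has_real_derivative U_smooth \<epsilon> x * (1 - U_smooth \<epsilon> x) / \<epsilon>) (at x)"
proof -
  have pos: "1 + exp (- x / \<epsilon>) > 0"
    by (simp add: add_pos_pos)
  have "((\<lambda>x. 1 / (1 + exp (- x / \<epsilon>))) has_real_derivative
      - (exp (- x / \<epsilon>) * (- 1 / \<epsilon>)) / (1 + exp (- x / \<epsilon>))\<^sup>2) (at x)"
    using pos assms by (auto intro!: derivative_eq_intros simp: power2_eq_square)
  also have "- (exp (- x / \<epsilon>) * (- 1 / \<epsilon>)) / (1 + exp (- x / \<epsilon>))\<^sup>2 = U_smooth \<epsilon> x * (1 - U_smooth \<epsilon> x) / \<epsilon>"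
    using pos assms by (simp add: U_smooth_def divide_simps power2_eq_square)
  finally show ?thesis
    unfolding U_smooth_def[abs_def] .
qed

text \<open>Mean value inequality, with the crude bound 1 for U (1 - U) in place of 1/4.\<close>

lemma U_smooth_Lipschitz:
  assumes "\<epsilon> > 0"
  shows "\<bar>U_smooth \<epsilon> x - U_smooth \<epsilon> y\<bar> \<le> \<bar>x - y\<bar> / \<epsilon>"
proof -
  have "norm (U_smooth \<epsilon> x - U_smooth \<epsilon> y) \<le> 1 / \<epsilon> * norm (x - y)"
  proof (rule field_differentiable_bound[of UNIV])
    fix z :: real
    show "(U_smooth \<epsilon> has_field_derivative U_smooth \<epsilon> z * (1 - U_smooth \<epsilon> z) / \<epsilon>) (at z within UNIV)"
      using U_smooth_has_derivative[OF assms] by simp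
    have "\<bar>U_smooth \<epsilon> z * (1 - U_smooth \<epsilon> z)\<bar> \<le> 1"
      using U_smooth_bounds[of \<epsilon> z] mult_mono[of "U_smooth \<epsilon> z" 1 "1 - U_smooth \<epsilon> z" 1]
      by (simp add: abs_mult)
    then show "norm (U_smooth \<epsilon> z * (1 - U_smooth \<epsilon> z) / \<epsilon>) \<le> 1 / \<epsilon>"
      using assms by (simp add: divide_right_mono)
  qed auto
  then show ?thesis by simp
qed

text \<open>Mean value inequality for the function minus its linear part at \<open>a\<close>. Within
  distance |h| of \<open>a\<close> the derivative of this difference is at most |h| / \<epsilon> by
  the Lipschitz bound; a second factor |h| is the length of the step.\<close>

lemma smooth_pos_remainder:
  assumes "\<epsilon> > 0"
  shows "\<bar>smooth_pos \<epsilon> (a + h) - smooth_pos \<epsilon> a - U_smooth \<epsilon> a * h\<bar> \<le> h\<^sup>2 / \<epsilon>"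
proof -
  let ?f = "\<lambda>x. smooth_pos \<epsilon> x - U_smooth \<epsilon> a * x"
  have "norm (?f (a + h) - ?f a) \<le> \<bar>h\<bar> / \<epsilon> * norm (a + h - a)"
  proof (rule field_differentiable_bound[of "cball a \<bar>h\<bar>"])
    fix z assume z: "z \<in> cball a \<bar>h\<bar>"
    show "(?f has_field_derivative U_smooth \<epsilon> z - U_smooth \<epsilon> a) (at z within cball a \<bar>h\<bar>)"
      by (auto intro!: derivative_eq_intros DERIV_subset[OF smooth_pos_has_derivative[OF assms]])
    show "norm (U_smooth \<epsilon> z - U_smooth \<epsilon> a) \<le> \<bar>h\<bar> / \<epsilon>"
      using U_smooth_Lipschitz[OF assms, of z a] z assms
      by (auto simp: dist_real_def field_simps)
  qed (auto simp: dist_real_def)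
  then show ?thesis
    by (simp add: algebra_simps power2_eq_square flip: abs_mult)
qed

lemma smooth_pos_measurable [measurable]: "\<epsilon> > 0 \<Longrightarrow> smooth_pos \<epsilon> \<in> borel_measurable borel"
  unfolding smooth_pos_def[abs_def] by measurable

lemma U_smooth_measurable [measurable]: "U_smooth \<epsilon> \<in> borel_measurable borel"
  unfolding U_smooth_def[abs_def] by measurable

context prob_space
begin

text \<open>The remainder estimate at \<open>a = 0\<close> already gives an integrable majorant on
  \<open>Lp_space M 2\<close>, so no separate growth estimate is made.\<close>

lemma smooth_pos_integrable:
  assumes "\<epsilon> > 0" and X: "X \<in> Lp_space M 2"
  shows "integrable M (\<lambda>\<omega>. smooth_pos \<epsilon> (X \<omega>))"
proof (rule Bochner_Integration.integrable_bound)
  have mes [measurable]: "X \<in> borel_measurable M"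
    using X by (simp add: Lp_space_2_iff)
  show "(\<lambda>\<omega>. smooth_pos \<epsilon> (X \<omega>)) \<in> borel_measurable M"
    using \<open>\<epsilon> > 0\<close> by measurable
  show "integrable M (\<lambda>\<omega>. \<bar>smooth_pos \<epsilon> 0\<bar> + \<bar>X \<omega>\<bar> + (X \<omega>)\<^sup>2 / \<epsilon>)"
    using X Lp_space_2_integrable[OF X] by (simp add: Lp_space_2_iff)
  have "\<bar>smooth_pos \<epsilon> x\<bar> \<le> \<bar>smooth_pos \<epsilon> 0\<bar> + \<bar>x\<bar> + x\<^sup>2 / \<epsilon>" for x
  proof -
    have "\<bar>U_smooth \<epsilon> 0 * x\<bar> \<le> \<bar>x\<bar>"
      using U_smooth_bounds[of \<epsilon> 0] by (simp add: abs_mult mult_left_le_one_le)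
    then show ?thesis
      using smooth_pos_remainder[OF \<open>\<epsilon> > 0\<close>, of 0 x] by auto
  qed
  then show "AE \<omega> in M. norm (smooth_pos \<epsilon> (X \<omega>)) \<le> norm (\<bar>smooth_pos \<epsilon> 0\<bar> + \<bar>X \<omega>\<bar> + (X \<omega>)\<^sup>2 / \<epsilon>)"
    unfolding real_norm_def by (intro AE_I2 order_trans[OF _ abs_ge_self])
qed

text \<open>Used for random variables on \<open>M\<close> and, in the theorem, for a shifted
  identity on the real line under \<open>\<mu>\<close>.\<close>

lemma U_smooth_expectation_bounds:
  assumes "X \<in> borel_measurable M"
  shows "integrable M (\<lambda>\<omega>. U_smooth \<epsilon> (X \<omega>))"
    "0 \<le> (\<integral>\<omega>. U_smooth \<epsilon> (X \<omega>) \<partial>M)" "(\<integral>\<omega>. U_smooth \<epsilon> (X \<omega>) \<partial>M) \<le> 1"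
proof -
  have le1: "U_smooth \<epsilon> x \<le> 1" and ge0: "0 \<le> U_smooth \<epsilon> x" for x
    using U_smooth_bounds[of \<epsilon> x] by auto
  show int: "integrable M (\<lambda>\<omega>. U_smooth \<epsilon> (X \<omega>))"
    using assms by (intro integrable_const_bound[of _ 1]) (auto simp: ge0 le1)
  show "0 \<le> (\<integral>\<omega>. U_smooth \<epsilon> (X \<omega>) \<partial>M)"
    by (simp add: ge0)
  show "(\<integral>\<omega>. U_smooth \<epsilon> (X \<omega>) \<partial>M) \<le> 1"
    using int le1 by (intro integral_le_const) auto
qed

text \<open>The pointwise remainder at \<open>Z \<omega>\<close> with step \<open>V \<omega>\<close>
  is integrated. Its linear term E[W V] equals E[(W - E W) Y], which is the pairing of Y with the
  bracket in \<open>D\<close>.\<close>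

lemma rho_MD_plus_has_derivative:
  assumes "\<beta> > 0" "\<epsilon> > 0" and X: "X \<in> Lp_space M 2"
  defines "D \<equiv> \<lambda>\<omega>. 1 + \<beta> * (U_smooth \<epsilon> (X \<omega> - expectation X)
      - (\<integral>\<omega>. U_smooth \<epsilon> (X \<omega> - expectation X) \<partial>M))"
  shows "has_Lp_derivative M 2 (rho_MD_plus M \<beta> \<epsilon>) D X" "D \<in> Lp_space M \<infinity>"
proof -
  define Z where "Z = (\<lambda>\<omega>. X \<omega> - expectation X)"
  define W where "W = (\<lambda>\<omega>. U_smooth \<epsilon> (Z \<omega>))"
  have Z: "Z \<in> Lp_space M 2"
    unfolding Z_def by (rule Lp_space_2_diff_const[OF X])
  have mZ [measurable]: "Z \<in> borel_measurable M"
    using Z by (simp add: Lp_space_2_iff)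
  note W_bounds = U_smooth_expectation_bounds[OF mZ, of \<epsilon>, folded W_def]
  have mW [measurable]: "W \<in> borel_measurable M"
    unfolding W_def by measurable
  have D_eq: "D = (\<lambda>\<omega>. 1 + \<beta> * (W \<omega> - expectation W))"
    by (simp add: D_def W_def Z_def)
  have mD [measurable]: "D \<in> borel_measurable M"
    unfolding D_eq by measurable
  have D_le: "\<bar>D \<omega>\<bar> \<le> 1 + \<beta>" for \<omega>
  proof -
    have "\<bar>W \<omega> - expectation W\<bar> \<le> 1"
      using W_bounds U_smooth_bounds[of \<epsilon> "Z \<omega>"] by (simp add: W_def abs_le_iff)
    from mult_left_mono[OF this, of \<beta>] have "\<bar>\<beta> * (W \<omega> - expectation W)\<bar> \<le> \<beta>"
      using \<open>\<beta> > 0\<close> by (simp add: abs_mult)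
    then show ?thesis
      unfolding D_eq by linarith
  qed
  then show "D \<in> Lp_space M \<infinity>"
    by (intro Lp_space_infI[of _ "1 + \<beta>"]) auto
  have D: "D \<in> Lp_space M 2"
  proof -
    have "(D \<omega>)\<^sup>2 \<le> (1 + \<beta>)\<^sup>2" for \<omega>
      using D_le[of \<omega>] by (metis abs_ge_zero power2_abs power_mono)
    then have "integrable M (\<lambda>\<omega>. (D \<omega>)\<^sup>2)"
      by (intro integrable_const_bound[of _ "(1 + \<beta>)\<^sup>2"]) auto
    then show ?thesis
      by (simp add: Lp_space_2_iff)
  qed
  show "has_Lp_derivative M 2 (rho_MD_plus M \<beta> \<epsilon>) D X"
  proof (rule has_Lp_derivativeI_quadratic[where r = 1 and C = "\<beta> / \<epsilon>"])
    fix Y assume Y: "Y \<in> Lp_space M 2"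
    define V where "V = (\<lambda>\<omega>. Y \<omega> - expectation Y)"
    note iX = Lp_space_2_integrable[OF X] and iY = Lp_space_2_integrable[OF Y]
    have V: "V \<in> Lp_space M 2"
      unfolding V_def by (rule Lp_space_2_diff_const[OF Y])
    have W: "W \<in> Lp_space M 2"
    proof -
      have "(W \<omega>)\<^sup>2 \<le> 1" for \<omega>
        using U_smooth_bounds[of \<epsilon> "Z \<omega>"] by (simp add: W_def power_le_one)
      then have "integrable M (\<lambda>\<omega>. (W \<omega>)\<^sup>2)"
        by (intro integrable_const_bound[of _ 1]) auto
      then show ?thesis
        by (simp add: Lp_space_2_iff)
    qed
    note iWY = Lp_space_2_integrable_mult[OF W Y] and iWV = Lp_space_2_integrable_mult[OF W V]
    have DY: "(\<integral>\<omega>. D \<omega> * Y \<omega> \<partial>M) = expectation Y + \<beta> * (\<integral>\<omega>. W \<omega> * V \<omega> \<partial>M)"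
    proof -
      have "(\<integral>\<omega>. D \<omega> * Y \<omega> \<partial>M) = (\<integral>\<omega>. Y \<omega> + \<beta> * ((W \<omega> - expectation W) * Y \<omega>) \<partial>M)"
        by (simp add: D_eq algebra_simps)
      also have "\<dots> = expectation Y + \<beta> * (\<integral>\<omega>. (W \<omega> - expectation W) * Y \<omega> \<partial>M)"
        using iY iWY by (simp add: left_diff_distrib)
      also have "(\<integral>\<omega>. (W \<omega> - expectation W) * Y \<omega> \<partial>M) = (\<integral>\<omega>. W \<omega> * V \<omega> \<partial>M)"
        unfolding V_def by (rule expectation_centered_mult[OF W_bounds(1) iY iWY])
      finally show ?thesis .
    qed
    define R where "R = (\<lambda>\<omega>. smooth_pos \<epsilon> (Z \<omega> + V \<omega>) - smooth_pos \<epsilon> (Z \<omega>) - W \<omega> * V \<omega>)"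
    note iZV = smooth_pos_integrable[OF \<open>\<epsilon> > 0\<close> Lp_space_2_add[OF Z V]]
      and iZ = smooth_pos_integrable[OF \<open>\<epsilon> > 0\<close> Z]
    have iR: "integrable M R"
      unfolding R_def using iZV iZ iWV by simp
    have "(\<lambda>\<omega>. X \<omega> + Y \<omega> - (\<integral>\<omega>'. X \<omega>' + Y \<omega>' \<partial>M)) = (\<lambda>\<omega>. Z \<omega> + V \<omega>)"
      using iX iY by (auto simp: Z_def V_def)
    then have eq: "X \<omega> + Y \<omega> - (\<integral>\<omega>'. X \<omega>' + Y \<omega>' \<partial>M) = Z \<omega> + V \<omega>" for \<omega>
      by (rule fun_cong)
    have rem: "rho_MD_plus M \<beta> \<epsilon> (\<lambda>\<omega>. X \<omega> + Y \<omega>) - rho_MD_plus M \<beta> \<epsilon> X - (\<integral>\<omega>. D \<omega> * Y \<omega> \<partial>M)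
        = \<beta> * expectation R"
      using iX iY iZV iZ iWV unfolding rho_MD_plus_def DY eq R_def
      by (simp add: Z_def[symmetric] algebra_simps) (simp add: Z_def)
    have "\<bar>expectation R\<bar> \<le> (\<integral>\<omega>. \<bar>R \<omega>\<bar> \<partial>M)"
      by (rule integral_abs_bound)
    also have "\<dots> \<le> (\<integral>\<omega>. (V \<omega>)\<^sup>2 / \<epsilon> \<partial>M)"
      using iR V smooth_pos_remainder[OF \<open>\<epsilon> > 0\<close>]
      by (intro integral_mono) (auto simp: Lp_space_2_iff R_def W_def)
    also have "\<dots> = (Lp_norm M 2 V)\<^sup>2 / \<epsilon>"
      by (simp add: Lp_norm_2_power2)
    also have "\<dots> \<le> (Lp_norm M 2 Y)\<^sup>2 / \<epsilon>"
      using Lp_norm_2_centered_le[OF Y] \<open>\<epsilon> > 0\<close> unfolding V_def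
      by (intro divide_right_mono power_mono) (auto simp: Lp_norm_2_nonneg)
    finally have "\<bar>expectation R\<bar> \<le> (Lp_norm M 2 Y)\<^sup>2 / \<epsilon>" .
    from mult_left_mono[OF this, of \<beta>]
    show "\<bar>rho_MD_plus M \<beta> \<epsilon> (\<lambda>\<omega>. X \<omega> + Y \<omega>) - rho_MD_plus M \<beta> \<epsilon> X - (\<integral>\<omega>. D \<omega> * Y \<omega> \<partial>M)\<bar>
        \<le> \<beta> / \<epsilon> * (Lp_norm M 2 Y)\<^sup>2"
      unfolding rem using \<open>\<beta> > 0\<close> by (simp add: abs_mult)
  qed (use X D assms(1,2) bounded_linear_functional_Lp_2[OF D] in \<open>auto simp: conj_exponent_2\<close>)
qed

end

section \<open>The entropic risk measure\<close>

text \<open>For x = - y < 0 the upper bound comes from the lower Taylor bound for exp y by taking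
  reciprocals: the quadratics 1 - y + y^2 and 1 + y + y^2 / 2 have product at least 1.\<close>

lemma exp_le_quadratic:
  fixes x :: real
  assumes "\<bar>x\<bar> \<le> 1"
  shows "exp x \<le> 1 + x + x\<^sup>2"
proof (cases "x \<ge> 0")
  case True
  then show ?thesis using assms by (simp add: exp_bound)
next
  case False
  define y where "y = - x"
  have y: "y > 0" using False by (simp add: y_def)
  have "1 \<le> (1 - y + y\<^sup>2) * (1 + y + y\<^sup>2 / 2)"
  proof -
    have "(1 - y + y\<^sup>2) * (1 + y + y\<^sup>2 / 2) = 1 + y\<^sup>2 / 2 + y ^ 3 / 2 + y ^ 4 / 2"
      by (simp add: field_simps power2_eq_square power3_eq_cube power4_eq_xxxx)
    then show ?thesis using y by simp
  qed
  also have "\<dots> \<le> (1 - y + y\<^sup>2) * exp y"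
  proof (rule mult_left_mono)
    show "1 + y + y\<^sup>2 / 2 \<le> exp y"
      using y by (intro exp_lower_Taylor_quadratic) simp
    show "0 \<le> 1 - y + y\<^sup>2"
      using assms by (simp add: y_def)
  qed
  finally have "exp (- y) \<le> 1 - y + y\<^sup>2"
    by (simp add: exp_minus field_simps)
  then show ?thesis by (simp add: y_def)
qed

context prob_space
begin

lemma expectation_exp_pos:
  fixes f :: "'a \<Rightarrow> real"
  assumes "integrable M (\<lambda>\<omega>. exp (f \<omega>))"
  shows "0 < (\<integral>\<omega>. exp (f \<omega>) \<partial>M)"
proof -
  have "(\<integral>\<omega>. exp (f \<omega>) \<partial>M) \<noteq> 0"
    using integral_nonneg_eq_0_iff_AE[OF assms] by auto
  then show ?thesis
    by (simp add: less_le)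
qed

text \<open>Under the tilted law with density \<open>D\<close>, the increment of the risk measure is a log-Laplace
  transform, whose distance to the tilted mean of \<open>Y\<close> lies between 0 (Jensen) and a quadratic term
  (because \<open>exp x \<le> 1 + x + x\<^sup>2\<close> for small \<open>x\<close>).\<close>

lemma rho_Ent_has_derivative:
  assumes "\<theta> > 0" and X: "X \<in> Lp_space M \<infinity>"
  shows "has_Lp_derivative M \<infinity> (rho_Ent M \<theta>)
    (\<lambda>\<omega>. exp (\<theta> * X \<omega>) / (\<integral>\<omega>'. exp (\<theta> * X \<omega>') \<partial>M)) X"
proof -
  define z where "z = (\<integral>\<omega>. exp (\<theta> * X \<omega>) \<partial>M)"
  define D where "D = (\<lambda>\<omega>. exp (\<theta> * X \<omega>) / z)"
  have z: "z > 0"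
    unfolding z_def by (intro expectation_exp_pos Lp_space_inf_exp_integrable X)
  have iD: "integrable M D"
    unfolding D_def using Lp_space_inf_exp_integrable[OF X] by simp
  have D_pos: "D \<omega> > 0" for \<omega>
    using z by (simp add: D_def)
  have D_1: "expectation D = 1"
    using z by (simp add: D_def z_def[symmetric])
  have D: "D \<in> Lp_space M 1"
    using iD D_pos by (simp add: Lp_space_def less_imp_le)
  have "has_Lp_derivative M \<infinity> (rho_Ent M \<theta>) D X"
  \<comment> \<open>Within this radius |\<theta> Y| is at most 1 almost surely, as
    \<open>exp_le_quadratic\<close> requires. The remainder (\<theta> n)^2 is divided by \<theta>,
    which leaves the constant \<theta>.\<close>
  proof (rule has_Lp_derivativeI_quadratic[where r = "1 / \<theta>" and C = \<theta>])
    fix Y assume Y: "Y \<in> Lp_space M \<infinity>" and small: "\<bar>Lp_norm M \<infinity> Y\<bar> < 1 / \<theta>"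
    define n where "n = Lp_norm M \<infinity> Y"
    define a where "a = (\<integral>\<omega>. D \<omega> * Y \<omega> \<partial>M)"
    define e where "e = (\<integral>\<omega>. D \<omega> * exp (\<theta> * Y \<omega>) \<partial>M)"
    have iDY: "integrable M (\<lambda>\<omega>. D \<omega> * Y \<omega>)"
      by (rule Lp_space_inf_mult_integrable[OF iD Y])
    have De: "D \<omega> * exp (\<theta> * Y \<omega>) = exp (\<theta> * (X \<omega> + Y \<omega>)) / z" for \<omega>
      by (simp add: D_def distrib_left exp_add)
    note iXY = Lp_space_inf_exp_integrable[OF Lp_space_inf_add[OF X Y], of \<theta>]
    have iDe: "integrable M (\<lambda>\<omega>. D \<omega> * exp (\<theta> * Y \<omega>))"
      unfolding De using iXY by simp
    have e_eq: "e = (\<integral>\<omega>. exp (\<theta> * (X \<omega> + Y \<omega>)) \<partial>M) / z"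
      unfolding e_def De by simp
    have e_pos: "e > 0"
      unfolding e_eq using expectation_exp_pos[OF iXY] z by simp
    have incr: "rho_Ent M \<theta> (\<lambda>\<omega>. X \<omega> + Y \<omega>) - rho_Ent M \<theta> X = ln e / \<theta>"
      unfolding e_eq rho_Ent_def using expectation_exp_pos[OF iXY] z
      by (simp add: ln_div diff_divide_distrib flip: z_def)
    \<comment> \<open>Jensen by hand: exp x \<ge> 1 + x at x = \<theta> Y - \<theta> a, integrated
      against \<open>D\<close>. Since \<open>a\<close> is the mean of Y under the density
      \<open>D\<close>, the linear term integrates to 0.\<close>
    have "\<theta> * a \<le> ln e"
    proof -
      have "1 = (\<integral>\<omega>. D \<omega> * (1 + (\<theta> * Y \<omega> - \<theta> * a)) \<partial>M)"
      proof -
        have "(\<integral>\<omega>. D \<omega> * (1 + (\<theta> * Y \<omega> - \<theta> * a)) \<partial>M)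
            = (\<integral>\<omega>. (1 - \<theta> * a) * D \<omega> + \<theta> * (D \<omega> * Y \<omega>) \<partial>M)"
          by (simp add: algebra_simps)
        also have "\<dots> = 1"
          using iD iDY by (simp add: D_1 flip: a_def)
        finally show ?thesis by simp
      qed
      also have "\<dots> \<le> (\<integral>\<omega>. D \<omega> * exp (\<theta> * Y \<omega> - \<theta> * a) \<partial>M)"
      proof (rule integral_mono)
        have "integrable M (\<lambda>\<omega>. (1 - \<theta> * a) * D \<omega> + \<theta> * (D \<omega> * Y \<omega>))"
          using iD iDY by simp
        then show "integrable M (\<lambda>\<omega>. D \<omega> * (1 + (\<theta> * Y \<omega> - \<theta> * a)))"
          by (simp add: algebra_simps)
        have "integrable M (\<lambda>\<omega>. D \<omega> * exp (\<theta> * Y \<omega>) / exp (\<theta> * a))"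
          using iDe by simp
        then show "integrable M (\<lambda>\<omega>. D \<omega> * exp (\<theta> * Y \<omega> - \<theta> * a))"
          by (simp add: exp_diff)
        show "D \<omega> * (1 + (\<theta> * Y \<omega> - \<theta> * a)) \<le> D \<omega> * exp (\<theta> * Y \<omega> - \<theta> * a)" for \<omega>
          using D_pos[of \<omega>] by (intro mult_left_mono exp_ge_add_one_self) auto
      qed
      also have "\<dots> = e / exp (\<theta> * a)"
        by (simp add: exp_diff e_def)
      finally show ?thesis
        using e_pos by (simp add: ln_ge_iff field_simps)
    qed
    \<comment> \<open>The quadratic bound on exp, integrated against \<open>D\<close>, controls
      \<open>e - 1\<close>, and ln e \<le> e - 1.\<close>
    moreover have "ln e \<le> \<theta> * a + (\<theta> * n)\<^sup>2"
    proof -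
      have "e \<le> (\<integral>\<omega>. (1 + (\<theta> * n)\<^sup>2) * D \<omega> + \<theta> * (D \<omega> * Y \<omega>) \<partial>M)"
        unfolding e_def
      proof (rule integral_mono_AE[OF iDe])
        show "AE \<omega> in M. D \<omega> * exp (\<theta> * Y \<omega>) \<le> (1 + (\<theta> * n)\<^sup>2) * D \<omega> + \<theta> * (D \<omega> * Y \<omega>)"
          using Lp_space_inf_AE(2)[OF Y]
        proof eventually_elim
          case (elim \<omega>)
          have le: "\<bar>\<theta> * Y \<omega>\<bar> \<le> \<theta> * n"
            using elim \<open>\<theta> > 0\<close> by (simp add: abs_mult n_def)
          also have "\<theta> * n \<le> 1"
            using small \<open>\<theta> > 0\<close> Lp_space_inf_AE(1)[OF Y] by (simp add: n_def field_simps)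
          finally have "\<bar>\<theta> * Y \<omega>\<bar> \<le> 1" .
          then have "exp (\<theta> * Y \<omega>) \<le> 1 + \<theta> * Y \<omega> + (\<theta> * Y \<omega>)\<^sup>2"
            by (rule exp_le_quadratic)
          moreover have "(\<theta> * Y \<omega>)\<^sup>2 \<le> (\<theta> * n)\<^sup>2"
            using le by (metis abs_ge_zero power2_abs power_mono)
          ultimately have "exp (\<theta> * Y \<omega>) \<le> 1 + (\<theta> * n)\<^sup>2 + \<theta> * Y \<omega>"
            by simp
          from mult_left_mono[OF this, of "D \<omega>"] show ?case
            using D_pos[of \<omega>] by (simp add: algebra_simps)
        qed
      qed (use iD iDY in simp)
      also have "\<dots> = 1 + (\<theta> * a + (\<theta> * n)\<^sup>2)"
        using iD iDY by (simp add: D_1 flip: a_def)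
      finally show ?thesis
        using ln_le_minus_one[OF e_pos] by simp
    qed
    ultimately have "\<bar>ln e - \<theta> * a\<bar> \<le> (\<theta> * n)\<^sup>2"
      by simp
    then have "\<bar>ln e - \<theta> * a\<bar> / \<theta> \<le> (\<theta> * n)\<^sup>2 / \<theta>"
      using \<open>\<theta> > 0\<close> by (simp add: divide_right_mono)
    moreover have "\<bar>ln e - \<theta> * a\<bar> / \<theta> = \<bar>ln e / \<theta> - a\<bar>"
    proof -
      have "ln e / \<theta> - a = (ln e - \<theta> * a) / \<theta>"
        using \<open>\<theta> > 0\<close> by (simp add: field_simps)
      then show ?thesis
        using \<open>\<theta> > 0\<close> by (simp add: abs_divide)
    qed
    ultimately show "\<bar>rho_Ent M \<theta> (\<lambda>\<omega>. X \<omega> + Y \<omega>) - rho_Ent M \<theta> X - (\<integral>\<omega>. D \<omega> * Y \<omega> \<partial>M)\<bar>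
        \<le> \<theta> * (Lp_norm M \<infinity> Y)\<^sup>2"
      unfolding incr a_def[symmetric] n_def[symmetric] using \<open>\<theta> > 0\<close>
      by (simp add: power2_eq_square mult.left_commute)
  qed (use X D \<open>\<theta> > 0\<close> bounded_linear_functional_Lp_inf[OF iD] in \<open>auto simp: conj_exponent_def\<close>)
  then show ?thesis
    by (simp add: D_def z_def)
qed

end

section \<open>Law invariance\<close>

lemma integral_law:
  fixes f :: "real \<Rightarrow> real"
  assumes "X \<in> Lp_space M p" "f \<in> borel_measurable borel"
  shows "(\<integral>\<omega>. f (X \<omega>) \<partial>M) = (\<integral>x. f x \<partial>distr M borel X)"
  using assms by (simp add: Lp_space_def integral_distr)

lemma law_invariant_rho_MD: "law_invariant M 2 (rho_MD M \<beta>)"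
  unfolding law_invariant_def rho_MD_def Lp_norm_2
  by (auto simp: integral_law[of _ M 2 "\<lambda>x. x"] integral_law[of _ M 2 "\<lambda>x. (x - _)\<^sup>2"])

lemma law_invariant_rho_MD_plus: "\<epsilon> > 0 \<Longrightarrow> law_invariant M 2 (rho_MD_plus M \<beta> \<epsilon>)"
  unfolding law_invariant_def rho_MD_plus_def
  by (auto simp: integral_law[of _ M 2 "\<lambda>x. x"] integral_law[of _ M 2 "\<lambda>x. smooth_pos \<epsilon> (x - _)"])

lemma law_invariant_rho_Ent: "law_invariant M \<infinity> (rho_Ent M \<theta>)"
  unfolding law_invariant_def rho_Ent_def
  by (auto simp: integral_law[of _ M \<infinity> "\<lambda>x. exp (\<theta> * x)"])

text \<open>Links the two forms of nondegeneracy: a law that is not Dirac, and a random variable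
  that is not almost surely constant.\<close>

lemma (in prob_space) not_AE_const_if_law_not_return:
  assumes "X \<in> borel_measurable M" "distr M borel X \<noteq> return borel c"
  shows "\<not> (AE \<omega> in M. X \<omega> = c)"
proof
  assume "AE \<omega> in M. X \<omega> = c"
  then have "distr M borel X = distr M borel (\<lambda>_. c)"
    using assms(1) by (intro distr_cong_AE) auto
  then show False
    using assms(2) by (simp add: distr_const)
qed

lemma has_L_derivativeI:
  assumes "law_invariant M p \<rho>"
    and "\<And>X. X \<in> Lp_space M p \<Longrightarrow> distr M borel X = \<mu> \<Longrightarrow>
      has_Lp_derivative M p \<rho> (\<lambda>\<omega>. g (X \<omega>)) X"
  shows "has_L_derivative M p \<rho> g \<mu>"
  using assms unfolding has_L_derivative_def by blast

theorem lemma5p2: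
  fixes M :: "'a measure" and \<beta> \<epsilon> \<theta> :: real
  assumes "prob_space M" and "\<beta> > 0" and "\<epsilon> > 0" and "\<theta> > 0"
  shows
    "(\<forall>X\<in>Lp_space M 2. \<not> (\<exists>c. AE \<omega> in M. X \<omega> = c) \<longrightarrow>
        has_Lp_derivative M 2 (rho_MD M \<beta>)
          (\<lambda>\<omega>. 1 + \<beta> * ((X \<omega> - (\<integral>\<omega>'. X \<omega>' \<partial>M)) / Lp_norm M 2 (\<lambda>\<omega>''. X \<omega>'' - (\<integral>\<omega>'. X \<omega>' \<partial>M)))) X) \<and>
     ((\<exists>A\<in>sets M. 0 < measure M A \<and> measure M A < 1) \<longrightarrow>
        (\<forall>X\<in>Lp_space M 2. (AE \<omega> in M. X \<omega> = (\<integral>\<omega>'. X \<omega>' \<partial>M)) \<longrightarrow>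
          \<not> (\<exists>L. has_Frechet_derivative_Lp M 2 (rho_MD M \<beta>) L X))) \<and>
     (\<forall>\<mu>\<in>prob_measures_Lp 2. (\<forall>a. \<mu> \<noteq> return borel a) \<longrightarrow>
        has_L_derivative M 2 (rho_MD M \<beta>)
          (\<lambda>x. 1 + \<beta> * ((x - (\<integral>x'. x' \<partial>\<mu>)) / sqrt (\<integral>x''. (x'' - (\<integral>x'. x' \<partial>\<mu>))\<^sup>2 \<partial>\<mu>))) \<mu>) \<and>
     (\<forall>x. (smooth_pos \<epsilon> has_real_derivative U_smooth \<epsilon> x) (at x)) \<and>
     (\<forall>X\<in>Lp_space M 2.
        (let D = (\<lambda>\<omega>. 1 + \<beta> * (U_smooth \<epsilon> (X \<omega> - (\<integral>\<omega>'. X \<omega>' \<partial>M))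
                    - (\<integral>\<omega>''. U_smooth \<epsilon> (X \<omega>'' - (\<integral>\<omega>'. X \<omega>' \<partial>M)) \<partial>M)))
         in has_Lp_derivative M 2 (rho_MD_plus M \<beta> \<epsilon>) D X \<and> D \<in> Lp_space M \<infinity>)) \<and>
     (\<forall>\<mu>\<in>prob_measures_Lp 2.
        (let g = (\<lambda>x. 1 + \<beta> * (U_smooth \<epsilon> (x - (\<integral>x'. x' \<partial>\<mu>))
                    - (\<integral>x''. U_smooth \<epsilon> (x'' - (\<integral>x'. x' \<partial>\<mu>)) \<partial>\<mu>)))
         in has_L_derivative M 2 (rho_MD_plus M \<beta> \<epsilon>) g \<mu> \<and> (\<forall>x. g x \<in> {1 - \<beta><..<1 + \<beta>}))) \<and>
     (\<forall>X\<in>Lp_space M \<infinity>.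
        has_Lp_derivative M \<infinity> (rho_Ent M \<theta>)
          (\<lambda>\<omega>. exp (\<theta> * X \<omega>) / (\<integral>\<omega>'. exp (\<theta> * X \<omega>') \<partial>M)) X) \<and>
     (\<forall>\<mu>\<in>prob_measures_Lp \<infinity>.
        has_L_derivative M \<infinity> (rho_Ent M \<theta>)
          (\<lambda>x. exp (\<theta> * x) / (\<integral>x'. exp (\<theta> * x') \<partial>\<mu>)) \<mu>)"
proof -
  interpret prob_space M by fact
  have MD_deriv: "has_Lp_derivative M 2 (rho_MD M \<beta>)
      (\<lambda>\<omega>. 1 + \<beta> * ((X \<omega> - expectation X) / Lp_norm M 2 (\<lambda>\<omega>. X \<omega> - expectation X))) X"
    if "X \<in> Lp_space M 2" "\<not> (\<exists>c. AE \<omega> in M. X \<omega> = c)" for X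
    using rho_MD_has_derivative that assms by blast
  have MD_no_deriv: "\<not> has_Frechet_derivative_Lp M 2 (rho_MD M \<beta>) L X"
    if "A \<in> sets M" "0 < measure M A" "measure M A < 1" "X \<in> Lp_space M 2"
      "AE \<omega> in M. X \<omega> = expectation X" for A X L
    using rho_MD_not_differentiable that assms by blast
  have MD_L_deriv: "has_L_derivative M 2 (rho_MD M \<beta>)
      (\<lambda>x. 1 + \<beta> * ((x - (\<integral>x'. x' \<partial>\<mu>)) / sqrt (\<integral>x''. (x'' - (\<integral>x'. x' \<partial>\<mu>))\<^sup>2 \<partial>\<mu>))) \<mu>"
    if "\<forall>a. \<mu> \<noteq> return borel a" for \<mu>
  proof (rule has_L_derivativeI[OF law_invariant_rho_MD])
    fix X assume X: "X \<in> Lp_space M 2" and \<mu>: "distr M borel X = \<mu>"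
    have "\<not> (\<exists>c. AE \<omega> in M. X \<omega> = c)"
      using not_AE_const_if_law_not_return[of X] X \<mu> that by (auto simp: Lp_space_2_iff)
    from MD_deriv[OF X this]
    show "has_Lp_derivative M 2 (rho_MD M \<beta>) (\<lambda>\<omega>. 1 + \<beta> * ((X \<omega> - (\<integral>x'. x' \<partial>\<mu>)) /
        sqrt (\<integral>x''. (x'' - (\<integral>x'. x' \<partial>\<mu>))\<^sup>2 \<partial>\<mu>))) X"
      \<comment> \<open>The mean is transferred to the law first; it is then a constant inside the
        integrand of the variance.\<close>
      using integral_law[OF X, of "\<lambda>x. x"] integral_law[OF X, of "\<lambda>x. (x - expectation X)\<^sup>2"]
      by (simp add: Lp_norm_2 \<mu>)
  qed
  have MDp_L_deriv: "has_L_derivative M 2 (rho_MD_plus M \<beta> \<epsilon>) (\<lambda>x. 1 + \<beta> * (U_smooth \<epsilon> (x - (\<integral>x'. x' \<partial>\<mu>))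
      - (\<integral>x''. U_smooth \<epsilon> (x'' - (\<integral>x'. x' \<partial>\<mu>)) \<partial>\<mu>))) \<mu>" for \<mu>
  proof (rule has_L_derivativeI[OF law_invariant_rho_MD_plus[OF \<open>\<epsilon> > 0\<close>]])
    fix X assume X: "X \<in> Lp_space M 2" and \<mu>: "distr M borel X = \<mu>"
    from rho_MD_plus_has_derivative(1)[OF \<open>\<beta> > 0\<close> \<open>\<epsilon> > 0\<close> X]
    show "has_Lp_derivative M 2 (rho_MD_plus M \<beta> \<epsilon>) (\<lambda>\<omega>. 1 + \<beta> * (U_smooth \<epsilon> (X \<omega> - (\<integral>x'. x' \<partial>\<mu>))
        - (\<integral>x''. U_smooth \<epsilon> (x'' - (\<integral>x'. x' \<partial>\<mu>)) \<partial>\<mu>))) X"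
      using integral_law[OF X, of "\<lambda>x. x"] integral_law[OF X, of "\<lambda>x. U_smooth \<epsilon> (x - expectation X)"]
      by (simp add: \<mu>)
  qed
  have MDp_range: "1 + \<beta> * (U_smooth \<epsilon> (x - m) - (\<integral>x''. U_smooth \<epsilon> (x'' - m) \<partial>\<mu>)) \<in> {1 - \<beta><..<1 + \<beta>}"
    if "\<mu> \<in> prob_measures_Lp 2" for \<mu> x m
  proof -
    \<comment> \<open>The law itself serves as the probability space, so the range claim does not
      depend on \<open>\<mu>\<close> being the law of some X on \<open>M\<close>.\<close>
    interpret \<mu>: prob_space \<mu>
      using that by (simp add: prob_measures_Lp_def)
    have [measurable_cong]: "sets \<mu> = sets borel"
      using that by (simp add: prob_measures_Lp_def)
    have "(\<lambda>x. x - m) \<in> borel_measurable \<mu>"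
      by measurable
    \<comment> \<open>Strictness comes from the value of U, which lies in the open interval (0, 1);
      for its mean the closed interval [0, 1] is enough.\<close>
    then have *: "\<bar>U_smooth \<epsilon> (x - m) - (\<integral>x''. U_smooth \<epsilon> (x'' - m) \<partial>\<mu>)\<bar> < 1"
      using \<mu>.U_smooth_expectation_bounds(2,3)[of "\<lambda>x. x - m" \<epsilon>] U_smooth_bounds[of \<epsilon> "x - m"]
      by (simp add: abs_less_iff)
    from mult_strict_left_mono[OF this \<open>\<beta> > 0\<close>]
    have "\<bar>\<beta> * (U_smooth \<epsilon> (x - m) - (\<integral>x''. U_smooth \<epsilon> (x'' - m) \<partial>\<mu>))\<bar> < \<beta>"
      using \<open>\<beta> > 0\<close> by (simp add: abs_mult)
    then show ?thesis
      unfolding greaterThanLessThan_iff abs_less_iff by linarith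
  qed
  have Ent_L_deriv: "has_L_derivative M \<infinity> (rho_Ent M \<theta>) (\<lambda>x. exp (\<theta> * x) / (\<integral>x'. exp (\<theta> * x') \<partial>\<mu>)) \<mu>" for \<mu>
  proof (rule has_L_derivativeI[OF law_invariant_rho_Ent])
    fix X assume X: "X \<in> Lp_space M \<infinity>" and \<mu>: "distr M borel X = \<mu>"
    from rho_Ent_has_derivative[OF \<open>\<theta> > 0\<close> X]
    show "has_Lp_derivative M \<infinity> (rho_Ent M \<theta>)
        (\<lambda>\<omega>. exp (\<theta> * X \<omega>) / (\<integral>x'. exp (\<theta> * x') \<partial>\<mu>)) X"
      using integral_law[OF X, of "\<lambda>x. exp (\<theta> * x)"] by (simp add: \<mu>)
  qed
  show ?thesis
    unfolding Let_def
  proof (intro conjI ballI impI allI, goal_cases)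
    case (1 X)
    then show ?case by (rule MD_deriv)
  next
    case (2 X)
    then show ?case using MD_no_deriv by blast
  next
    case (3 \<mu>)
    then show ?case by (intro MD_L_deriv)
  next
    case (4 x)
    show ?case by (rule smooth_pos_has_derivative[OF \<open>\<epsilon> > 0\<close>])
  next
    case (5 X)
    then show ?case by (rule rho_MD_plus_has_derivative(1)[OF \<open>\<beta> > 0\<close> \<open>\<epsilon> > 0\<close>])
  next
    case (6 X)
    then show ?case by (rule rho_MD_plus_has_derivative(2)[OF \<open>\<beta> > 0\<close> \<open>\<epsilon> > 0\<close>])
  next
    case (7 \<mu>)
    show ?case by (rule MDp_L_deriv)
  next
    case (8 \<mu> x)
    then show ?case by (rule MDp_range)
  next
    case (9 X)
    then show ?case by (rule rho_Ent_has_derivative[OF \<open>\<theta> > 0\<close>])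
  next
    case (10 \<mu>)
    show ?case by (rule Ent_L_deriv)
  qed
qed

end
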